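(* Let $\alpha$ and $\beta$ be a pair of Mannheim curves in $S^3$, parametrized by arc length $s$ and $\sigma$ respectively, let $a(s)$ be the angle function of the pair and $d(s)$ the distance function of the pair. Then: (a) the angle function $a(s)$ is constant; (b) the distance function $d(s)$ is constant; (c) the angle $\theta$ between the tangent vectors $T_\alpha$ and $T_\beta$ at corresponding points, $\cos\theta=\langle T_\alpha,T_\beta\rangle$, is not constant; (d) the angle between the binormal vectors $B_\alpha$ and $B_\beta$ at corresponding points is constant.
   Context: $S^3=\{x\in\mathbb{R}^4:\langle x,x\rangle=1\}$ is the unit sphere with Levi-Civita connection $\overline{\nabla}$. All curves are smooth, immersed, defined on open intervals and parametrized by arc length. A curve in $S^3$ with nowhere zero curvature $\kappa$ has a Frenet frame $\{T,N,B\}$ (orthonormal, tangent to $S^3$ along the curve, $T$ the unit tangent) with $\overline{\nabla}_TT=\kappa N$, $\overline{\nabla}_TN=-\kappa T+\tau B$, $\overline{\nabla}_TB=-\tau N$; $\tau$ is the torsion. Tangent vectors of $S^3$ are viewed as vectors in $\mathbb{R}^4$, so vectors at different points can be compared using the Euclidean inner product of $\mathbb{R}^4$. The principal normal geodesic of $\alpha$ at $\alpha(s)$ is the great circle $u\mapsto\cos(u)\alpha(s)+\sin(u)N_\alpha(s)$; the binormal geodesic of $\beta$ at $\beta(\sigma)$ is the great circle $u\mapsto\cos(u)\beta(\sigma)+\sin(u)B_\beta(\sigma)$, $u\in\mathbb{R}$. An immersed curve $\alpha=\alpha(s)$, $s\in I$, in $S^3$ with nowhere zero curvature $\kappa_\alpha$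 is a Mannheim curve if there are another immersed curve $\beta=\beta(\sigma)$, $\sigma\in J$, in $S^3$ (with nowhere zero curvature $\kappa_\beta$, so that its Frenet frame is defined) and a one-to-one correspondence $\sigma\leftrightarrow s(\sigma)$ between them (a diffeomorphism $J\to I$, with inverse $s\mapsto\sigma(s)$) such that at corresponding points $\alpha(s(\sigma))$ and $\beta(\sigma)$ the principal normal geodesic of $\alpha$ coincides (as a great circle) with the binormal geodesic of $\beta$. Then $\alpha,\beta$ are called a pair of Mannheim curves. For such a pair there is a differentiable function $a$, called the angle function, with $\alpha(s(\sigma))=\cos(a)\,\beta(\sigma)-\sin(a)\,B_\beta(\sigma)$, where $a=a(s)$ is evaluated at $s=s(\sigma)$. The distance function $d(s)$ is the distance in $S^3$ between the corresponding points $\alpha(s)$ and $\beta(\sigma(s))$; when $0\le a\le 2\pi$, $d(s)=\min\{a(s),2\pi-a(s)\}$. *)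

theory Defs
  imports "HOL-Analysis.Analysis"
begin

(* Used only for open sets S, where it is C-infinity differentiability on S. *)
definition smooth_on :: "real set \<Rightarrow> (real \<Rightarrow> 'a::real_normed_vector) \<Rightarrow> bool" where
  "smooth_on S f \<longleftrightarrow>
     (\<forall>n. ((\<lambda>g t. vector_derivative g (at t)) ^^ n) f differentiable_on S)"

definition open_interval :: "real set \<Rightarrow> bool" where
  "open_interval I \<longleftrightarrow> open I \<and> is_interval I \<and> I \<noteq> {}"

definition diffeomorphism :: "real set \<Rightarrow> real set \<Rightarrow> (real \<Rightarrow> real) \<Rightarrow> (real \<Rightarrow> real) \<Rightarrow> bool" where
  "diffeomorphism J I f g \<longleftrightarrow> homeomorphism J I f g \<and> smooth_on J f \<and> smooth_on I g"

(* The Levi-Civita connection of the sphere is the tangential part of the Euclidean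
   derivative: along a curve c in S^3, the derivative of the field V is projected
   orthogonally to the hyperplane c(t)^\<bottom>, the tangent space of S^3 at c(t). *)
definition covariant_deriv :: "(real \<Rightarrow> real^4) \<Rightarrow> (real \<Rightarrow> real^4) \<Rightarrow> real \<Rightarrow> real^4" where
  "covariant_deriv c V t =
     vector_derivative V (at t) - (vector_derivative V (at t) \<bullet> c t) *\<^sub>R c t"

(* A curve together with a Frenet frame, its curvature and its torsion. *)
record frenet_curve =
  param_dom :: "real set"
  curve :: "real \<Rightarrow> real^4"
  tangent :: "real \<Rightarrow> real^4"
  normal :: "real \<Rightarrow> real^4"
  binormal :: "real \<Rightarrow> real^4"
  curvature :: "real \<Rightarrow> real"
  torsion :: "real \<Rightarrow> real"

(* Parametrization by arc length, hence immersion, is the conjunction of the first equation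
   for the tangent and its unit length.  Neither the sign of the curvature nor the
   orientation of the frame is normalized. *)
definition is_frenet_curve :: "frenet_curve \<Rightarrow> bool" where
  "is_frenet_curve A \<longleftrightarrow>
     open_interval (param_dom A) \<and>
     smooth_on (param_dom A) (curve A) \<and>
     smooth_on (param_dom A) (normal A) \<and>
     smooth_on (param_dom A) (binormal A) \<and>
     (\<forall>t \<in> param_dom A.
        curve A t \<in> sphere 0 1 \<and>
        tangent A t = vector_derivative (curve A) (at t) \<and>
        tangent A t \<bullet> curve A t = 0 \<and> normal A t \<bullet> curve A t = 0 \<and> binormal A t \<bullet> curve A t = 0 \<and>
        norm (tangent A t) = 1 \<and> norm (normal A t) = 1 \<and> norm (binormal A t) = 1 \<and>
        tangent A t \<bullet> normal A t = 0 \<and> tangent A t \<bullet> binormal A t = 0 \<and>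
        normal A t \<bullet> binormal A t = 0 \<and>
        curvature A t \<noteq> 0 \<and>
        covariant_deriv (curve A) (tangent A) t = curvature A t *\<^sub>R normal A t \<and>
        covariant_deriv (curve A) (normal A) t =
          - curvature A t *\<^sub>R tangent A t + torsion A t *\<^sub>R binormal A t \<and>
        covariant_deriv (curve A) (binormal A) t = - torsion A t *\<^sub>R normal A t)"

definition great_circle :: "real^4 \<Rightarrow> real^4 \<Rightarrow> (real^4) set" where
  "great_circle p v = range (\<lambda>u. cos u *\<^sub>R p + sin u *\<^sub>R v)"

definition principal_normal_geodesic :: "frenet_curve \<Rightarrow> real \<Rightarrow> (real^4) set" where
  "principal_normal_geodesic A t = great_circle (curve A t) (normal A t)"

definition binormal_geodesic :: "frenet_curve \<Rightarrow> real \<Rightarrow> (real^4) set" where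
  "binormal_geodesic B t = great_circle (curve B t) (binormal B t)"

(* The function s sends parameters of B to parameters of A, and \<sigma> is its inverse. *)
definition mannheim_pair ::
  "frenet_curve \<Rightarrow> frenet_curve \<Rightarrow> (real \<Rightarrow> real) \<Rightarrow> (real \<Rightarrow> real) \<Rightarrow> bool" where
  "mannheim_pair A B s \<sigma> \<longleftrightarrow>
     is_frenet_curve A \<and> is_frenet_curve B \<and>
     diffeomorphism (param_dom B) (param_dom A) s \<sigma> \<and>
     (\<forall>v \<in> param_dom B. principal_normal_geodesic A (s v) = binormal_geodesic B v)"

definition angle_function ::
  "frenet_curve \<Rightarrow> frenet_curve \<Rightarrow> (real \<Rightarrow> real) \<Rightarrow> (real \<Rightarrow> real) \<Rightarrow> bool" where
  "angle_function A B s a \<longleftrightarrow>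
     a differentiable_on param_dom A \<and>
     (\<forall>v \<in> param_dom B.
        curve A (s v) = cos (a (s v)) *\<^sub>R curve B v - sin (a (s v)) *\<^sub>R binormal B v)"

(* Length of the shorter great-circle arc between two points of the unit sphere. *)
definition sphere_dist :: "real^4 \<Rightarrow> real^4 \<Rightarrow> real" where
  "sphere_dist x y = arccos (x \<bullet> y)"

definition distance_function ::
  "frenet_curve \<Rightarrow> frenet_curve \<Rightarrow> (real \<Rightarrow> real) \<Rightarrow> real \<Rightarrow> real" where
  "distance_function A B \<sigma> t = sphere_dist (curve A t) (curve B (\<sigma> t))"

lemma sphere_dist_great_circle:
  assumes "norm p = 1" "p \<bullet> v = 0" "0 \<le> a" "a \<le> 2 * pi"
  shows "sphere_dist (cos a *\<^sub>R p - sin a *\<^sub>R v) p = min a (2 * pi - a)"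
proof -
  have "(cos a *\<^sub>R p - sin a *\<^sub>R v) \<bullet> p = cos a"
    using assms by (simp add: inner_diff_left inner_commute[of v p] dot_square_norm)
  moreover have "arccos (cos a) = min a (2 * pi - a)"
  proof (cases "a \<le> pi")
    case True
    then show ?thesis using assms by (simp add: arccos_cos)
  next
    case False
    then have "arccos (cos (2 * pi - a)) = 2 * pi - a"
      using assms by (intro arccos_cos) auto
    then show ?thesis using False by (simp add: cos_diff)
  qed
  ultimately show ?thesis by (simp add: sphere_dist_def)
qed

definition vec_angle :: "real^4 \<Rightarrow> real^4 \<Rightarrow> real" where
  "vec_angle u v = arccos (u \<bullet> v / (norm u * norm v))"

end

theory Submission
  imports Defs
begin

text \<open>
  Let \<open>\<alpha>\<close>, \<open>\<beta>\<close> be the two curves, compared at corresponding points.  Two great circles coincide only if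
  they span the same plane of \<open>\<real>\<^sup>4\<close>, so the hypothesis says that \<open>\<alpha>\<close>, \<open>N\<^sub>\<alpha>\<close> and \<open>\<beta>\<close>, \<open>B\<^sub>\<beta>\<close> span one plane.
  Hence \<open>T\<^sub>\<alpha>\<close>, \<open>B\<^sub>\<alpha>\<close>, \<open>T\<^sub>\<beta>\<close>, \<open>N\<^sub>\<beta>\<close> all lie in its orthogonal complement
  (\<open>orthogonal_to_equal_great_circle\<close>, \<open>mannheim_pair_orthogonal\<close>), and everything else follows from
  this by differentiating inner products.

  \<^item> The vector \<open>\<nu> = sin a \<beta> + cos a B\<^sub>\<beta>\<close> is orthogonal to \<open>\<alpha>\<close> inside that plane.  It is therefore
    orthogonal to the velocity of \<open>\<alpha>\<close>, while the formula \<open>\<alpha> = cos a \<beta> - sin a B\<^sub>\<beta>\<close> gives \<open>-a'\<close>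
    for their product.  So \<open>a' = 0\<close>, and with \<open>a\<close> also \<open>\<langle>\<alpha>, \<beta>\<rangle> = cos a\<close> is constant.
  \<^item> Since \<open>B\<^sub>\<alpha>\<close> and \<open>B\<^sub>\<beta>\<close> lie in orthogonal planes, their angle is always \<open>\<pi>/2\<close>.
  \<^item> In the Euclidean sense \<open>T\<^sub>\<alpha>\<close> changes only in directions of the plane of \<open>\<alpha>\<close> and \<open>N\<^sub>\<alpha>\<close>, which is orthogonal to
    \<open>T\<^sub>\<beta>\<close> and \<open>N\<^sub>\<beta>\<close>, so the coordinates \<open>c = \<langle>T\<^sub>\<alpha>, T\<^sub>\<beta>\<rangle>\<close> and \<open>n = \<langle>T\<^sub>\<alpha>, N\<^sub>\<beta>\<rangle>\<close> change only through the
    rotation of the frame of \<open>\<beta>\<close>: \<open>c' = \<kappa>\<^sub>\<beta> n\<close> and \<open>n' = - \<kappa>\<^sub>\<beta> c\<close>.  If \<open>c\<close> were constant, then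
    \<open>n = 0\<close> and so \<open>c = 0\<close>, which leaves no room in \<open>\<real>\<^sup>4\<close> for the unit vector \<open>T\<^sub>\<alpha>\<close>.
\<close>

section \<open>Frenet equations in Euclidean coordinates\<close>

lemma smooth_on_has_vector_derivative:
  assumes "smooth_on S f" "open S" "t \<in> S"
  shows "(f has_vector_derivative vector_derivative f (at t)) (at t)"
proof -
  have "f differentiable_on S"
    using assms(1) unfolding smooth_on_def by (auto dest: spec[of _ 0])
  then show ?thesis
    using assms by (simp add: differentiable_on_eq_differentiable_at vector_derivative_works)
qed

lemma smooth_on_vector_derivative_has_vector_derivative:
  assumes "smooth_on S f" "open S" "t \<in> S"
  shows "((\<lambda>u. vector_derivative f (at u)) has_vector_derivative
           vector_derivative (\<lambda>u. vector_derivative f (at u)) (at t)) (at t)"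
proof -
  have "(\<lambda>u. vector_derivative f (at u)) differentiable_on S"
    using assms(1) unfolding smooth_on_def by (auto dest: spec[of _ 1])
  then show ?thesis
    using assms by (simp add: differentiable_on_eq_differentiable_at vector_derivative_works)
qed

lemma has_vector_derivative_inner:
  assumes "(f has_vector_derivative f') (at t)" "(g has_vector_derivative g') (at t)"
  shows "((\<lambda>u. f u \<bullet> g u) has_vector_derivative (f t \<bullet> g' + f' \<bullet> g t)) (at t)"
  using bounded_bilinear.has_vector_derivative[OF bounded_bilinear_inner assms] .

text \<open>The Gauss formula: differentiating \<open>\<langle>V, c\<rangle> = 0\<close> turns the normal part \<open>\<langle>V', c\<rangle>\<close> of the
  Euclidean derivative into \<open>- \<langle>V, c'\<rangle>\<close>.\<close>

lemma tangent_field_has_vector_derivative: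
  assumes "open S" "t \<in> S" and tangential: "\<And>u. u \<in> S \<Longrightarrow> V u \<bullet> c u = 0"
    and V: "(V has_vector_derivative vector_derivative V (at t)) (at t)"
    and c: "(c has_vector_derivative c') (at t)"
  shows "(V has_vector_derivative covariant_deriv c V t - (V t \<bullet> c') *\<^sub>R c t) (at t)"
proof -
  have "((\<lambda>u. V u \<bullet> c u) has_vector_derivative 0) (at t)"
    by (rule has_vector_derivative_transform_within_open[of "\<lambda>_. 0", OF _ assms(1,2)])
      (simp_all add: tangential)
  then have "V t \<bullet> c' + vector_derivative V (at t) \<bullet> c t = 0"
    using has_vector_derivative_inner[OF V c] vector_derivative_unique_at by blast
  then have "covariant_deriv c V t - (V t \<bullet> c') *\<^sub>R c t = vector_derivative V (at t)"
    unfolding covariant_deriv_def by (simp add: add_eq_0_iff2)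
  then show ?thesis
    using V by simp
qed

text \<open>The Frenet equations with Euclidean derivatives.  Only the derivative of the tangent acquires
  a component along the curve, because \<open>N\<close> and \<open>B\<close> are orthogonal to the velocity.\<close>

lemma frenet_curve_has_vector_derivative:
  assumes A: "is_frenet_curve A" and t: "t \<in> param_dom A"
  shows "(curve A has_vector_derivative tangent A t) (at t)"
    and "(tangent A has_vector_derivative curvature A t *\<^sub>R normal A t - curve A t) (at t)"
    and "(normal A has_vector_derivative
           - curvature A t *\<^sub>R tangent A t + torsion A t *\<^sub>R binormal A t) (at t)"
    and "(binormal A has_vector_derivative - torsion A t *\<^sub>R normal A t) (at t)"
proof -
  let ?I = "param_dom A"
  have I: "open ?I"
    and smooth: "smooth_on ?I (curve A)" "smooth_on ?I (normal A)" "smooth_on ?I (binormal A)"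
    using A unfolding is_frenet_curve_def open_interval_def by auto
  have frame: "tangent A u = vector_derivative (curve A) (at u)"
      "tangent A u \<bullet> curve A u = 0" "normal A u \<bullet> curve A u = 0" "binormal A u \<bullet> curve A u = 0"
      "tangent A u \<bullet> tangent A u = 1" "tangent A u \<bullet> normal A u = 0" "tangent A u \<bullet> binormal A u = 0"
      "covariant_deriv (curve A) (tangent A) u = curvature A u *\<^sub>R normal A u"
      "covariant_deriv (curve A) (normal A) u =
        - curvature A u *\<^sub>R tangent A u + torsion A u *\<^sub>R binormal A u"
      "covariant_deriv (curve A) (binormal A) u = - torsion A u *\<^sub>R normal A u"
    if "u \<in> ?I" for u
    using A that unfolding is_frenet_curve_def by (auto simp: norm_eq_1)
  show curve: "(curve A has_vector_derivative tangent A t) (at t)"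
    using smooth_on_has_vector_derivative[OF smooth(1) I t] frame(1)[OF t] by simp
  have "(tangent A has_vector_derivative
      vector_derivative (\<lambda>u. vector_derivative (curve A) (at u)) (at t)) (at t)"
    by (rule has_vector_derivative_transform_within_open
          [OF smooth_on_vector_derivative_has_vector_derivative[OF smooth(1) I t] I t])
      (simp add: frame(1))
  then have "(tangent A has_vector_derivative vector_derivative (tangent A) (at t)) (at t)"
    using vector_derivative_at by metis
  from tangent_field_has_vector_derivative[OF I t frame(2) this curve]
  show "(tangent A has_vector_derivative curvature A t *\<^sub>R normal A t - curve A t) (at t)"
    using frame[OF t] by simp
  from tangent_field_has_vector_derivative[OF I t frame(3)
      smooth_on_has_vector_derivative[OF smooth(2) I t] curve]
  show "(normal A has_vector_derivative
           - curvature A t *\<^sub>R tangent A t + torsion A t *\<^sub>R binormal A t) (at t)"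
    using frame[OF t] by (simp add: inner_commute)
  from tangent_field_has_vector_derivative[OF I t frame(4)
      smooth_on_has_vector_derivative[OF smooth(3) I t] curve]
  show "(binormal A has_vector_derivative - torsion A t *\<^sub>R normal A t) (at t)"
    using frame[OF t] by (simp add: inner_commute)
qed

lemma frenet_curve_frame:
  assumes "is_frenet_curve A" "t \<in> param_dom A"
  shows "curve A t \<bullet> curve A t = 1" "tangent A t \<bullet> tangent A t = 1"
    "normal A t \<bullet> normal A t = 1" "binormal A t \<bullet> binormal A t = 1"
    "tangent A t \<bullet> curve A t = 0" "normal A t \<bullet> curve A t = 0" "binormal A t \<bullet> curve A t = 0"
    "tangent A t \<bullet> normal A t = 0" "tangent A t \<bullet> binormal A t = 0" "normal A t \<bullet> binormal A t = 0"
    "curvature A t \<noteq> 0"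
  using assms unfolding is_frenet_curve_def by (auto simp: norm_eq_1)

lemma orthogonal_to_frenet_frame_imp_zero:
  assumes A: "is_frenet_curve A" and t: "t \<in> param_dom A"
    and x: "x \<bullet> curve A t = 0" "x \<bullet> tangent A t = 0" "x \<bullet> normal A t = 0" "x \<bullet> binormal A t = 0"
  shows "x = 0"
proof (rule ccontr)
  assume "x \<noteq> 0"
  note frame = frenet_curve_frame[OF A t]
  let ?S = "{x, curve A t, tangent A t, normal A t, binormal A t}"
  have "pairwise orthogonal ?S"
    using x frame by (auto simp: pairwise_insert orthogonal_def inner_commute)
  moreover have "0 \<notin> ?S"
    using \<open>x \<noteq> 0\<close> frame by auto
  ultimately have "card ?S \<le> DIM(real^4)"
    using pairwise_orthogonal_independent independent_bound by blast
  moreover have "card ?S = 5"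
    using x frame \<open>x \<noteq> 0\<close> by (auto simp: card_insert_if inner_commute)
  ultimately show False
    by simp
qed

section \<open>Curves with a common normal great circle\<close>

text \<open>The points with parameters \<open>0\<close> and \<open>\<pi>/2\<close> of the second circle are \<open>q\<close> and \<open>w\<close>; as points of
  the first circle they are linear combinations of \<open>p\<close> and \<open>v\<close>.\<close>

lemma orthogonal_to_equal_great_circle:
  assumes "great_circle p v = great_circle q w" "x \<bullet> p = 0" "x \<bullet> v = 0"
  shows "x \<bullet> q = 0" "x \<bullet> w = 0"
proof -
  have *: "x \<bullet> y = 0" if "y \<in> great_circle q w" for y
    using that assms(2,3) unfolding assms(1)[symmetric]
    by (auto simp: great_circle_def inner_add_right)
  have "q \<in> great_circle q w"
    unfolding great_circle_def by (rule range_eqI[of _ _ 0]) simp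
  then show "x \<bullet> q = 0" by (rule *)
  have "w \<in> great_circle q w"
    unfolding great_circle_def by (rule range_eqI[of _ _ "pi / 2"]) simp
  then show "x \<bullet> w = 0" by (rule *)
qed

text \<open>The left factor of each product is a Frenet vector of one curve and is orthogonal there to both vectors
  spanning the common circle; equality of the circles carries this over to the other curve.\<close>

lemma mannheim_pair_orthogonal:
  assumes "mannheim_pair A B s \<sigma>" and v: "v \<in> param_dom B"
  shows "tangent A (s v) \<bullet> curve B v = 0" "tangent A (s v) \<bullet> binormal B v = 0"
    "binormal A (s v) \<bullet> binormal B v = 0"
    "tangent B v \<bullet> curve A (s v) = 0" "tangent B v \<bullet> normal A (s v) = 0"
    "normal B v \<bullet> curve A (s v) = 0" "normal B v \<bullet> normal A (s v) = 0"
proof -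
  have A: "is_frenet_curve A" and B: "is_frenet_curve B" and sv: "s v \<in> param_dom A"
    and circle: "great_circle (curve A (s v)) (normal A (s v)) =
      great_circle (curve B v) (binormal B v)"
    using assms unfolding mannheim_pair_def diffeomorphism_def homeomorphism_def
      principal_normal_geodesic_def binormal_geodesic_def by auto
  note frameA = frenet_curve_frame[OF A sv] and frameB = frenet_curve_frame[OF B v]
  show "tangent A (s v) \<bullet> curve B v = 0" "tangent A (s v) \<bullet> binormal B v = 0"
    using orthogonal_to_equal_great_circle[OF circle, of "tangent A (s v)"] frameA by auto
  show "binormal A (s v) \<bullet> binormal B v = 0"
    using orthogonal_to_equal_great_circle[OF circle, of "binormal A (s v)"] frameA
    by (auto simp: inner_commute)
  show "tangent B v \<bullet> curve A (s v) = 0" "tangent B v \<bullet> normal A (s v) = 0"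
    using orthogonal_to_equal_great_circle[OF circle[symmetric], of "tangent B v"] frameB by auto
  show "normal B v \<bullet> curve A (s v) = 0" "normal B v \<bullet> normal A (s v) = 0"
    using orthogonal_to_equal_great_circle[OF circle[symmetric], of "normal B v"] frameB by auto
qed

text \<open>Along the correspondence \<open>T\<^sub>\<alpha>\<close> has derivative \<open>s' (\<kappa>\<^sub>\<alpha> N\<^sub>\<alpha> - \<alpha>)\<close>, which is orthogonal to \<open>T\<^sub>\<beta>\<close> and
  \<open>N\<^sub>\<beta>\<close>; and \<open>T\<^sub>\<alpha>\<close> is orthogonal to \<open>\<beta>\<close> and \<open>B\<^sub>\<beta>\<close>.  So of all the terms of the product rule only those
  with \<open>\<kappa>\<^sub>\<beta>\<close> remain.\<close>

lemma mannheim_pair_tangent_rotation: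
  assumes M: "mannheim_pair A B s \<sigma>" and v: "v \<in> param_dom B"
  shows "((\<lambda>v. tangent A (s v) \<bullet> tangent B v) has_vector_derivative
           curvature B v * (tangent A (s v) \<bullet> normal B v)) (at v)"
    and "((\<lambda>v. tangent A (s v) \<bullet> normal B v) has_vector_derivative
           - curvature B v * (tangent A (s v) \<bullet> tangent B v)) (at v)"
proof -
  have A: "is_frenet_curve A" and B: "is_frenet_curve B" and sv: "s v \<in> param_dom A"
    and J: "open (param_dom B)" and s: "smooth_on (param_dom B) s"
    using M v unfolding mannheim_pair_def diffeomorphism_def homeomorphism_def
      is_frenet_curve_def open_interval_def by auto
  note orth = mannheim_pair_orthogonal[OF M v]
  note TA = vector_diff_chain_at[OF smooth_on_has_vector_derivative[OF s J v]
      frenet_curve_has_vector_derivative(2)[OF A sv], unfolded o_def]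
  show "((\<lambda>v. tangent A (s v) \<bullet> tangent B v) has_vector_derivative
           curvature B v * (tangent A (s v) \<bullet> normal B v)) (at v)"
    using has_vector_derivative_inner[OF TA frenet_curve_has_vector_derivative(2)[OF B v]] orth
    by (simp add: inner_simps inner_commute)
  show "((\<lambda>v. tangent A (s v) \<bullet> normal B v) has_vector_derivative
           - curvature B v * (tangent A (s v) \<bullet> tangent B v)) (at v)"
    using has_vector_derivative_inner[OF TA frenet_curve_has_vector_derivative(3)[OF B v]] orth
    by (simp add: inner_simps inner_commute)
qed

text \<open>The velocity of \<open>\<alpha>\<close> has no component along the common great circle, whereas moving the point
  along that circle at rate \<open>(a \<circ> s)'\<close> would produce exactly such a component; the frame
  terms \<open>\<beta>' = T\<^sub>\<beta>\<close> and \<open>B\<^sub>\<beta>' = - \<tau>\<^sub>\<beta> N\<^sub>\<beta>\<close> are orthogonal to the circle and cannot compensate.\<close>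

lemma mannheim_pair_angle_derivative_zero:
  assumes M: "mannheim_pair A B s \<sigma>" and a: "angle_function A B s a" and v: "v \<in> param_dom B"
  shows "((\<lambda>v. a (s v)) has_real_derivative 0) (at v)"
proof -
  have A: "is_frenet_curve A" and B: "is_frenet_curve B" and sv: "s v \<in> param_dom A"
    and I: "open (param_dom A)" and J: "open (param_dom B)" and s: "smooth_on (param_dom B) s"
    using M v unfolding mannheim_pair_def diffeomorphism_def homeomorphism_def
      is_frenet_curve_def open_interval_def by auto
  have "a differentiable (at (s v))"
    using a I sv unfolding angle_function_def by (simp add: differentiable_on_eq_differentiable_at)
  then have da: "(a has_vector_derivative vector_derivative a (at (s v))) (at (s v))"
    by (simp add: vector_derivative_works)
  note chain = vector_diff_chain_at[OF smooth_on_has_vector_derivative[OF s J v]]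
  from chain[OF da] obtain b' where b: "((\<lambda>v. a (s v)) has_real_derivative b') (at v)"
    by (auto simp: o_def has_real_derivative_iff_has_vector_derivative)
  let ?b = "a (s v)"
  define w where "w = sin ?b *\<^sub>R curve B v + cos ?b *\<^sub>R binormal B v"
  let ?rhs = "cos ?b *\<^sub>R tangent B v + (- sin ?b * b') *\<^sub>R curve B v
    - (sin ?b *\<^sub>R (- torsion B v *\<^sub>R normal B v) + (cos ?b * b') *\<^sub>R binormal B v)"
  have "((\<lambda>v. cos (a (s v)) *\<^sub>R curve B v - sin (a (s v)) *\<^sub>R binormal B v)
      has_vector_derivative ?rhs) (at v)"
    by (intro has_vector_derivative_diff has_vector_derivative_scaleR
        frenet_curve_has_vector_derivative[OF B v] DERIV_fun_cos DERIV_fun_sin b)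
  then have "((\<lambda>v. curve A (s v)) has_vector_derivative ?rhs) (at v)"
    by (rule has_vector_derivative_transform_within_open[OF _ J v])
      (use a in \<open>simp add: angle_function_def\<close>)
  then have "vector_derivative s (at v) *\<^sub>R tangent A (s v) = ?rhs"
    using chain[OF frenet_curve_has_vector_derivative(1)[OF A sv]] vector_derivative_unique_at
    unfolding o_def by blast
  \<comment> \<open>\<open>w\<close> is the tangent vector at \<open>\<alpha>\<close> of the common great circle, up to sign the principal normal of
      \<open>\<alpha>\<close>.\<close>
  then have "vector_derivative s (at v) * (tangent A (s v) \<bullet> w) = ?rhs \<bullet> w"
    by (metis inner_scaleR_left)
  also have "?rhs \<bullet> w = - (b' * ((sin ?b)\<^sup>2 + (cos ?b)\<^sup>2))"
    using frenet_curve_frame[OF B v] unfolding w_def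
    by (simp add: inner_simps inner_commute power2_eq_square algebra_simps
        del: sin_cos_squared_add sin_cos_squared_add2 sin_cos_squared_add3)
  also have "tangent A (s v) \<bullet> w = 0"
    using mannheim_pair_orthogonal[OF M v] unfolding w_def by (simp add: inner_simps)
  finally have "b' = 0"
    by simp
  then show ?thesis
    using b by simp
qed

section \<open>The angle between the tangents\<close>

lemma vec_angle_unit_eq_iff:
  assumes "norm x = 1" "norm y = 1" "norm z = 1" "norm w = 1"
  shows "vec_angle x y = vec_angle z w \<longleftrightarrow> x \<bullet> y = z \<bullet> w"
  using Cauchy_Schwarz_ineq2[of x y] Cauchy_Schwarz_ineq2[of z w] assms
  by (simp add: vec_angle_def arccos_eq_iff)

lemma mannheim_pair_tangent_angle_not_constant:
  assumes M: "mannheim_pair A B s \<sigma>"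
  shows "\<not> (\<lambda>t. vec_angle (tangent A t) (tangent B (\<sigma> t))) constant_on param_dom A"
proof
  assume const: "(\<lambda>t. vec_angle (tangent A t) (tangent B (\<sigma> t))) constant_on param_dom A"
  have A: "is_frenet_curve A" and B: "is_frenet_curve B"
    and sJ: "\<And>v. v \<in> param_dom B \<Longrightarrow> s v \<in> param_dom A"
    and inv: "\<And>v. v \<in> param_dom B \<Longrightarrow> \<sigma> (s v) = v"
    and J: "open (param_dom B)" and "param_dom B \<noteq> {}"
    using M unfolding mannheim_pair_def diffeomorphism_def homeomorphism_def
      is_frenet_curve_def open_interval_def by auto
  then obtain v where v: "v \<in> param_dom B" by auto
  have unit: "norm (tangent A (s u)) = 1" "norm (tangent B u) = 1" if "u \<in> param_dom B" for u
    using frenet_curve_frame(2)[OF A sJ[OF that]] frenet_curve_frame(2)[OF B that]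
    by (simp_all add: norm_eq_1)
  have cos_const: "tangent A (s u) \<bullet> tangent B u = tangent A (s v) \<bullet> tangent B v"
    if u: "u \<in> param_dom B" for u
  proof -
    have "vec_angle (tangent A (s u)) (tangent B u) = vec_angle (tangent A (s v)) (tangent B v)"
      using const sJ[OF u] sJ[OF v] inv[OF u] inv[OF v] unfolding constant_on_def by metis
    then show ?thesis
      using unit[OF u] unit[OF v] by (simp add: vec_angle_unit_eq_iff)
  qed
  have normal_zero: "tangent A (s u) \<bullet> normal B u = 0" if u: "u \<in> param_dom B" for u
  proof -
    have "((\<lambda>v. tangent A (s v) \<bullet> tangent B v) has_vector_derivative 0) (at u)"
      by (rule has_vector_derivative_transform_within_open
            [of "\<lambda>_. tangent A (s v) \<bullet> tangent B v", OF _ J u])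
        (simp_all add: cos_const)
    then have "curvature B u * (tangent A (s u) \<bullet> normal B u) = 0"
      using mannheim_pair_tangent_rotation(1)[OF M u] vector_derivative_unique_at by blast
    then show ?thesis
      using frenet_curve_frame(11)[OF B u] by simp
  qed
  have "((\<lambda>v. tangent A (s v) \<bullet> normal B v) has_vector_derivative 0) (at v)"
    by (rule has_vector_derivative_transform_within_open[of "\<lambda>_. 0", OF _ J v])
      (simp_all add: normal_zero)
  then have "- curvature B v * (tangent A (s v) \<bullet> tangent B v) = 0"
    using mannheim_pair_tangent_rotation(2)[OF M v] vector_derivative_unique_at by blast
  then have "tangent A (s v) \<bullet> tangent B v = 0"
    using frenet_curve_frame(11)[OF B v] by simp
  then have "tangent A (s v) = 0"
    using orthogonal_to_frenet_frame_imp_zero[OF B v] mannheim_pair_orthogonal[OF M v]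
      normal_zero[OF v] by blast
  then show False
    using unit[OF v] by simp
qed

theorem proposition2p1:
  fixes A B :: frenet_curve
    and s \<sigma> a :: "real \<Rightarrow> real"
  assumes "mannheim_pair A B s \<sigma>"
    and "angle_function A B s a"
  shows "a constant_on param_dom A
    \<and> distance_function A B \<sigma> constant_on param_dom A
    \<and> \<not> (\<lambda>t. vec_angle (tangent A t) (tangent B (\<sigma> t))) constant_on param_dom A
    \<and> (\<lambda>t. vec_angle (binormal A t) (binormal B (\<sigma> t))) constant_on param_dom A"
proof (intro conjI)
  have B: "is_frenet_curve B"
    and \<sigma>I: "\<And>t. t \<in> param_dom A \<Longrightarrow> \<sigma> t \<in> param_dom B"
    and inv: "\<And>t. t \<in> param_dom A \<Longrightarrow> s (\<sigma> t) = t"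
    and J: "is_interval (param_dom B)"
    using assms(1) unfolding mannheim_pair_def diffeomorphism_def homeomorphism_def
      is_frenet_curve_def open_interval_def by auto
  have "\<exists>k. \<forall>v \<in> param_dom B. a (s v) = k"
    using mannheim_pair_angle_derivative_zero[OF assms] is_interval_convex[OF J]
    by (metis has_field_derivative_zero_constant has_field_derivative_at_within)
  then obtain k where k: "\<And>t. t \<in> param_dom A \<Longrightarrow> a t = k"
    using \<sigma>I inv by metis
  then show "a constant_on param_dom A"
    unfolding constant_on_def by blast
  have "distance_function A B \<sigma> t = arccos (cos k)" if t: "t \<in> param_dom A" for t
  proof -
    have "curve A t = cos k *\<^sub>R curve B (\<sigma> t) - sin k *\<^sub>R binormal B (\<sigma> t)"
      using assms(2) \<sigma>I[OF t] inv[OF t] k[OF t] unfolding angle_function_def by metis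
    then show ?thesis
      using frenet_curve_frame[OF B \<sigma>I[OF t]]
      by (simp add: distance_function_def sphere_dist_def inner_simps)
  qed
  then show "distance_function A B \<sigma> constant_on param_dom A"
    unfolding constant_on_def by blast
  show "\<not> (\<lambda>t. vec_angle (tangent A t) (tangent B (\<sigma> t))) constant_on param_dom A"
    by (rule mannheim_pair_tangent_angle_not_constant[OF assms(1)])
  have "vec_angle (binormal A t) (binormal B (\<sigma> t)) = arccos 0" if t: "t \<in> param_dom A" for t
    using mannheim_pair_orthogonal(3)[OF assms(1) \<sigma>I[OF t]] inv[OF t]
    by (simp add: vec_angle_def)
  then show "(\<lambda>t. vec_angle (binormal A t) (binormal B (\<sigma> t))) constant_on param_dom A"
    unfolding constant_on_def by blast
qed

end
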